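(* $c(2,5)=7$ and $c(2,4)=8$; in particular $c(2,5)<c(2,4)$, so $c(n,k)$ is not monotonic (nondecreasing) in $k$.
   Context: For integers $n\ge1$, $k\ge0$, $c(n,k)$ denotes the least integer such that for every $m$, every matrix $A\in\mathbb{R}^{m\times n}$ and every $b\in\mathbb{R}^m$: if the polyhedron $\{x\in\mathbb{R}^n : Ax\le b\}$ contains exactly $k$ integer points (points of $\mathbb{Z}^n$), then there is a subset $I$ of the rows of $A$ with $|I|\le c(n,k)$ such that $\{x\in\mathbb{R}^n : A_Ix\le b_I\}$ contains exactly the same $k$ integer points, where $A_I,b_I$ are the restrictions to the rows in $I$. *)

theory Defs
  imports Complex_Main "Jordan_Normal_Form.Matrix"
begin

text \<open>
  \<open>rows_polyhedron A b I\<close> is the solution set of the subsystem of \<open>A x \<le> b\<close> formed by the rows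
  with index in \<open>I\<close>; the full polyhedron is the case \<open>I = {..<dim_row A}\<close>. Rows are counted by
  index, so repeated rows are distinct.
\<close>

definition rows_polyhedron :: "real mat \<Rightarrow> real vec \<Rightarrow> nat set \<Rightarrow> real vec set" where
  "rows_polyhedron A b I =
     {x \<in> carrier_vec (dim_col A). \<forall>i\<in>I. row A i \<bullet> x \<le> b $ i}"

definition integer_vecs :: "nat \<Rightarrow> real vec set" where
  "integer_vecs n = {x \<in> carrier_vec n. \<forall>j<n. x $ j \<in> \<int>}"

definition helly_bound :: "nat \<Rightarrow> nat \<Rightarrow> int \<Rightarrow> bool" where
  "helly_bound n k h \<longleftrightarrow>
     (\<forall>m. \<forall>A \<in> carrier_mat m n. \<forall>b \<in> carrier_vec m.
        finite (rows_polyhedron A b {..<m} \<inter> integer_vecs n) \<and>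
        card (rows_polyhedron A b {..<m} \<inter> integer_vecs n) = k \<longrightarrow>
        (\<exists>I \<subseteq> {..<m}. int (card I) \<le> h \<and>
           rows_polyhedron A b I \<inter> integer_vecs n
             = rows_polyhedron A b {..<m} \<inter> integer_vecs n))"

text \<open>Meaningful for \<open>n \<ge> 1\<close>, as in dimension 0 there is only one integer point.\<close>

definition helly_c :: "nat \<Rightarrow> nat \<Rightarrow> int" where
  "helly_c n k = (LEAST h. helly_bound n k h)"

end

theory Submission
  imports Defs
begin

text \<open>
For a planar system that has exactly \<open>k\<close> integer solutions and in which every row is needed,
relax the right-hand sides one after the other, each as far as possible without admitting a new
integer point strictly below it (the argument of Doignon, Bell and Scarf). Afterwards every row
\<open>i\<close> is tight at one lattice point \<open>v i\<close> and is strict at all the other points \<open>v j\<close> and at the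
\<open>k\<close> solutions. So the \<open>v i\<close> are vertices of the convex hull \<open>W\<close> of the \<open>v i\<close> and the solutions,
and \<open>W\<close> contains no further lattice points (lemmas \<open>tight_witnesses\<close> and \<open>irredundant_config\<close>).

Both upper bounds then follow from one fact: no lattice polygon with exactly 13 lattice points has
8 vertices or more (lemma \<open>card_8_5_impossible\<close>). A system with 4 solutions and 9 needed rows and
one with 5 solutions and 8 needed rows both produce such a polygon, since a marked vertex may
equally well be counted among the other points (lemma \<open>card_sum_le_12\<close>).

For this fact, mark 8 vertices and consider the 5 other lattice points. Two of them agree modulo 2,
so that their midpoint is a lattice point; this leads to three consecutive lattice points on a line,
and a unimodular map takes them to \<open>(-1, 0), (0, 0), (1, 0)\<close>. At most two of the other points lie
off the horizontal axis. Each horizontal line carries at most two vertices, so that the polygon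
meets at least four such lines, and by a convexity count on the row lengths it cannot meet only four
(lemma \<open>four_rows\<close>). But a point at height \<open>h\<close> spans with the three base points a triangle whose
lattice points at heights strictly between \<open>0\<close> and \<open>h\<close> all belong to the five (lemma \<open>cone\<close>).
This leaves very few ways to occupy five or more rows, and in each of them a count of the vertices
requires one on the axis, which forces a sixth point among the five (lemma \<open>flank\<close>).

The lower bounds come from one octagon with 4 lattice points besides its vertices. Eight rows, each
cutting off a single vertex, define these 4 points. If one of these rows is dropped, exactly its
vertex is added: 7 rows are needed for 5 points. Thus the fifth point comes at the price of a
vertex.
\<close>

section \<open>Lattice points in triangles\<close>

text \<open>
Membership of \<open>p\<close> in the (possibly degenerate) triangle \<open>s t u\<close>. Integer weights suffice because a
lattice point in a lattice triangle has rational barycentric coordinates.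
\<close>
definition hull3 :: "int \<times> int \<Rightarrow> int \<times> int \<Rightarrow> int \<times> int \<Rightarrow> int \<times> int \<Rightarrow> bool" where
  "hull3 s t u p \<longleftrightarrow> (\<exists>\<alpha> \<beta> \<gamma> :: int. \<alpha> \<ge> 0 \<and> \<beta> \<ge> 0 \<and> \<gamma> \<ge> 0 \<and> \<alpha> + \<beta> + \<gamma> > 0 \<and>
     (\<alpha> + \<beta> + \<gamma>) * fst p = \<alpha> * fst s + \<beta> * fst t + \<gamma> * fst u \<and>
     (\<alpha> + \<beta> + \<gamma>) * snd p = \<alpha> * snd s + \<beta> * snd t + \<gamma> * snd u)"

lemma hull3I:
  assumes "\<alpha> \<ge> 0" "\<beta> \<ge> 0" "\<gamma> \<ge> 0" "\<alpha> + \<beta> + \<gamma> > 0"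
    "(\<alpha> + \<beta> + \<gamma>) * fst p = \<alpha> * fst s + \<beta> * fst t + \<gamma> * fst u"
    "(\<alpha> + \<beta> + \<gamma>) * snd p = \<alpha> * snd s + \<beta> * snd t + \<gamma> * snd u"
  shows "hull3 s t u p"
  unfolding hull3_def using assms by blast

lemma hull3_affine:
  assumes "hull3 s t u p"
    and g: "\<And>x y. g (x, y) = (a * x + b * y + c, a' * x + b' * y + c')"
  shows "hull3 (g s) (g t) (g u) (g p)"
proof -
  obtain \<alpha> \<beta> \<gamma> where w: "\<alpha> \<ge> 0" "\<beta> \<ge> 0" "\<gamma> \<ge> 0" "\<alpha> + \<beta> + \<gamma> > 0"
    "(\<alpha> + \<beta> + \<gamma>) * fst p = \<alpha> * fst s + \<beta> * fst t + \<gamma> * fst u"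
    "(\<alpha> + \<beta> + \<gamma>) * snd p = \<alpha> * snd s + \<beta> * snd t + \<gamma> * snd u"
    using assms(1) unfolding hull3_def by blast
  have g': "g q = (a * fst q + b * snd q + c, a' * fst q + b' * snd q + c')" for q
    using g[of "fst q" "snd q"] by simp
  have lin: "(\<alpha> + \<beta> + \<gamma>) * (k * fst p + l * snd p + m) =
      \<alpha> * (k * fst s + l * snd s + m) + \<beta> * (k * fst t + l * snd t + m)
      + \<gamma> * (k * fst u + l * snd u + m)" for k l m
  proof -
    have "(\<alpha> + \<beta> + \<gamma>) * (k * fst p + l * snd p + m) =
      k * ((\<alpha> + \<beta> + \<gamma>) * fst p) + l * ((\<alpha> + \<beta> + \<gamma>) * snd p) + (\<alpha> + \<beta> + \<gamma>) * m"
      by (simp add: algebra_simps)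
    also have "\<dots> = \<alpha> * (k * fst s + l * snd s + m) + \<beta> * (k * fst t + l * snd t + m)
      + \<gamma> * (k * fst u + l * snd u + m)"
      unfolding w(5,6) by (simp add: algebra_simps)
    finally show ?thesis .
  qed
  show ?thesis
    using w(1-4) lin by (intro hull3I[of \<alpha> \<beta> \<gamma>]) (simp_all add: g')
qed

section \<open>Configurations of vertices and kernel points\<close>

text \<open>
A set \<open>V \<union> K\<close> that contains all lattice points of its convex hull and in which the points of \<open>V\<close> are
vertices. The assumption \<open>hull\<close> encodes both properties: a lattice point of a triangle with corners
in \<open>V \<union> K\<close> that is not a corner belongs to the set and is no vertex. Points of \<open>K\<close> may be vertices
too; this freedom is what makes it possible to move points from \<open>V\<close> to \<open>K\<close>.
\<close>
locale helly_config =
  fixes V K :: "(int \<times> int) set"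
  assumes finV: "finite V" and finK: "finite K" and disj: "V \<inter> K = {}"
    and hull: "\<And>s t u p. \<lbrakk>s \<in> V \<union> K; t \<in> V \<union> K; u \<in> V \<union> K; hull3 s t u p; p \<notin> {s, t, u}\<rbrakk> \<Longrightarrow> p \<in> K"
begin

lemma between:
  assumes "(x, y) \<in> V \<union> K" "(x', y) \<in> V \<union> K" "x < z" "z < x'"
  shows "(z, y) \<in> K"
proof (rule hull[OF assms(1,2,2)])
  show "hull3 (x, y) (x', y) (x', y) (z, y)"
    using assms by (intro hull3I[of "x' - z" "z - x" 0]) (auto simp: algebra_simps)
qed (use assms in auto)

lemma card_row_le: "card {v \<in> V. snd v = y} \<le> 2"
proof (rule ccontr)
  define F where "F = {x. (x, y) \<in> V}"
  have row: "{v \<in> V. snd v = y} = (\<lambda>x. (x, y)) ` F" unfolding F_def by auto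
  have "finite F" using finV unfolding F_def by (intro finite_vimageI[of V "\<lambda>x. (x, y)", unfolded vimage_def] inj_onI) auto
  assume "\<not> card {v \<in> V. snd v = y} \<le> 2"
  then have c: "card F > 2" unfolding row by (simp add: card_image inj_on_def)
  then have ne: "F \<noteq> {}" by auto
  have "\<not> F \<subseteq> {Min F, Max F}"
  proof
    assume "F \<subseteq> {Min F, Max F}"
    then have "card F \<le> card {Min F, Max F}" by (intro card_mono) auto
    also have "\<dots> \<le> 2" by (simp add: card_insert_if)
    finally show False using c by simp
  qed
  then obtain z where z: "z \<in> F" "z \<noteq> Min F" "z \<noteq> Max F" by blast
  have mem: "x \<in> F \<longleftrightarrow> (x, y) \<in> V" for x unfolding F_def by simp
  have "Min F \<in> F" "Max F \<in> F" using \<open>finite F\<close> ne by simp_all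
  moreover have "Min F < z" "z < Max F"
    using z Min_le[OF \<open>finite F\<close> z(1)] Max_ge[OF \<open>finite F\<close> z(1)] by linarith+
  ultimately have "(z, y) \<in> K" by (intro between[of "Min F" y "Max F"]) (auto simp: mem)
  then show False using z disj mem by auto
qed

text \<open>
Otherwise \<open>(l1, y)\<close> lies between \<open>(r1, y)\<close> and the midpoint of the other two points, hence is not
a vertex. The weights in the proof are those of this representation after clearing denominators.
\<close>
lemma left_strictly_convex:
  assumes "(l0, y - 1) \<in> V \<union> K" "(l2, y + 1) \<in> V \<union> K" "(l1, y) \<in> V" "(r1, y) \<in> V \<union> K" "l1 < r1"
  shows "2 * l1 < l0 + l2"
proof (rule ccontr)
  assume "\<not> 2 * l1 < l0 + l2"
  then have "(l1, y) \<in> K"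
    using assms
    by (intro hull[OF assms(1,2,4)] hull3I[of "r1 - l1" "r1 - l1" "2 * l1 - l0 - l2"])
      (auto simp: algebra_simps)
  then show False using assms disj by auto
qed

lemma right_strictly_convex:
  assumes "(r0, y - 1) \<in> V \<union> K" "(r2, y + 1) \<in> V \<union> K" "(r1, y) \<in> V" "(l1, y) \<in> V \<union> K" "l1 < r1"
  shows "r0 + r2 < 2 * r1"
proof (rule ccontr)
  assume "\<not> r0 + r2 < 2 * r1"
  then have "(r1, y) \<in> K"
    using assms
    by (intro hull[OF assms(1,2,4)] hull3I[of "r1 - l1" "r1 - l1" "r0 + r2 - 2 * r1"])
      (auto simp: algebra_simps)
  then show False using assms disj by auto
qed

lemma full_row:
  assumes "card {v \<in> V. snd v = y} = 2"
  obtains l r where "l < r" "(l, y) \<in> V" "(r, y) \<in> V" "int (card {s \<in> K. snd s = y}) = r - l - 1"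
proof -
  obtain v w where vw: "{v \<in> V. snd v = y} = {v, w}" "v \<noteq> w"
    using assms by (auto simp: card_2_iff)
  define l r where "l = min (fst v) (fst w)" and "r = max (fst v) (fst w)"
  have m: "v \<in> V" "w \<in> V" "snd v = y" "snd w = y" using vw by auto
  then have "(fst v, y) \<in> V" "(fst w, y) \<in> V" "fst v \<noteq> fst w"
    using vw(2) by (metis prod.collapse, metis prod.collapse, metis prod_eqI)
  then have lr: "l < r" "(l, y) \<in> V" "(r, y) \<in> V"
    unfolding l_def r_def min_def max_def by auto
  have "{s \<in> K. snd s = y} = (\<lambda>x. (x, y)) ` {l<..<r}"
  proof (intro equalityI subsetI)
    fix s assume "s \<in> {s \<in> K. snd s = y}"
    then obtain x where s: "s = (x, y)" "(x, y) \<in> K" by (cases s) auto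
    have "x \<noteq> l" "x \<noteq> r" using s lr disj by auto
    moreover have "\<not> x < l" using between[of x y r l] s lr disj by auto
    moreover have "\<not> x > r" using between[of l y x r] s lr disj by auto
    ultimately show "s \<in> (\<lambda>x. (x, y)) ` {l<..<r}" using s by auto
  next
    fix s assume "s \<in> (\<lambda>x. (x, y)) ` {l<..<r}"
    then show "s \<in> {s \<in> K. snd s = y}" using between[of l y r] lr by auto
  qed
  then have "card {s \<in> K. snd s = y} = card {l<..<r}"
    by (simp add: card_image inj_on_def)
  then show thesis using that[of l r] lr by simp
qed

text \<open>
With eight vertices on four rows each row has two of them, which are its end points. Strict
convexity on both sides makes the row lengths strictly concave: twice an inner length exceeds the
sum of its neighbours by at least 2. The lengths sum to 9 (13 points on 4 rows), so the outer
lengths are 1, the inner ones sum to 7, and both of these would have to be at least 4.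
\<close>
lemma four_rows:
  assumes "card V = 8" "card K = 5" and rows: "\<And>s. s \<in> V \<union> K \<Longrightarrow> snd s \<in> {-1..2}"
  shows False
proof -
  have split: "card T = card {s \<in> T. snd s = -1} + card {s \<in> T. snd s = 0}
      + card {s \<in> T. snd s = 1} + card {s \<in> T. snd s = 2}"
    if "finite T" "\<And>s. s \<in> T \<Longrightarrow> snd s \<in> {-1..2}" for T :: "(int \<times> int) set"
  proof -
    have "T = {s \<in> T. snd s = -1} \<union> {s \<in> T. snd s = 0} \<union> {s \<in> T. snd s = 1} \<union> {s \<in> T. snd s = 2}"
      using that(2) by fastforce
    then have "card T = card ({s \<in> T. snd s = -1} \<union> {s \<in> T. snd s = 0} \<union> {s \<in> T. snd s = 1}
      \<union> {s \<in> T. snd s = 2})" by simp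
    also have "\<dots> = card {s \<in> T. snd s = -1} + card {s \<in> T. snd s = 0}
      + card {s \<in> T. snd s = 1} + card {s \<in> T. snd s = 2}"
      using that(1) by (subst card_Un_disjoint; auto)+
    finally show ?thesis .
  qed
  have two: "card {v \<in> V. snd v = -1} = 2" "card {v \<in> V. snd v = 0} = 2"
    "card {v \<in> V. snd v = 1} = 2" "card {v \<in> V. snd v = 2} = 2"
    using split[OF finV] rows assms(1) card_row_le[of "-1"] card_row_le[of 0] card_row_le[of 1]
      card_row_le[of 2] by auto
  obtain l0 r0 where 0: "l0 < r0" "(l0, -1) \<in> V" "(r0, -1) \<in> V"
    "int (card {s \<in> K. snd s = -1}) = r0 - l0 - 1" using full_row[OF two(1)] by blast
  obtain l1 r1 where 1: "l1 < r1" "(l1, 0) \<in> V" "(r1, 0) \<in> V"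
    "int (card {s \<in> K. snd s = 0}) = r1 - l1 - 1" using full_row[OF two(2)] by blast
  obtain l2 r2 where 2: "l2 < r2" "(l2, 1) \<in> V" "(r2, 1) \<in> V"
    "int (card {s \<in> K. snd s = 1}) = r2 - l2 - 1" using full_row[OF two(3)] by blast
  obtain l3 r3 where 3: "l3 < r3" "(l3, 2) \<in> V" "(r3, 2) \<in> V"
    "int (card {s \<in> K. snd s = 2}) = r3 - l3 - 1" using full_row[OF two(4)] by blast
  have c: "2 * l1 < l0 + l2" "2 * l2 < l1 + l3" "r0 + r2 < 2 * r1" "r1 + r3 < 2 * r2"
    using left_strictly_convex[of l0 0 l2 l1 r1] left_strictly_convex[of l1 1 l3 l2 r2]
      right_strictly_convex[of r0 0 r2 r1 l1] right_strictly_convex[of r1 1 r3 r2 l2] 0 1 2 3 by simp_all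
  have sum: "(r0 - l0 - 1) + (r1 - l1 - 1) + (r2 - l2 - 1) + (r3 - l3 - 1) = 5"
    using split[OF finK] rows assms(2) 0(4) 1(4) 2(4) 3(4) by auto
  define w0 w1 w2 w3 where w: "w0 = r0 - l0" "w1 = r1 - l1" "w2 = r2 - l2" "w3 = r3 - l3"
  have "w0 + w2 + 2 \<le> 2 * w1" using c(1,3) unfolding w by simp
  moreover have "w1 + w3 + 2 \<le> 2 * w2" using c(2,4) unfolding w by simp
  moreover have "w0 + w1 + w2 + w3 = 9" using sum unfolding w by simp
  moreover have "w0 \<ge> 1" "w3 \<ge> 1" using 0(1) 3(1) unfolding w by simp_all
  ultimately have "w0 = 1" "w3 = 1" "w1 + w2 = 7" "2 * w1 \<ge> w2 + 3" "2 * w2 \<ge> w1 + 3" by linarith+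
  then show False by presburger
qed

lemma affine_image:
  assumes g: "\<And>x y. g (x, y) = (a * x + b * y + c, a' * x + b' * y + c')"
    and g': "\<And>x y. g' (x, y) = (d * x + e * y + f, d' * x + e' * y + f')"
    and inv: "\<And>p. g (g' p) = p" "\<And>p. g' (g p) = p"
  shows "helly_config (g ` V) (g ` K)"
proof
  have inj: "inj g" using inv(2) by (metis injI)
  show "g ` V \<inter> g ` K = {}" using disj by (metis image_Int[OF inj] image_empty)
  fix s t u p
  assume "s \<in> g ` V \<union> g ` K" "t \<in> g ` V \<union> g ` K" "u \<in> g ` V \<union> g ` K"
    and h: "hull3 s t u p" and n: "p \<notin> {s, t, u}"
  then have "g' s \<in> V \<union> K" "g' t \<in> V \<union> K" "g' u \<in> V \<union> K" using inv(2) by auto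
  moreover have "hull3 (g' s) (g' t) (g' u) (g' p)" by (rule hull3_affine[OF h g'])
  moreover have "g' p \<notin> {g' s, g' t, g' u}" using n inv(1) by (metis insert_iff singletonD)
  ultimately have "g' p \<in> K" by (rule hull)
  then show "p \<in> g ` K" using inv(1) by (metis imageI)
qed (use finV finK in auto)

text \<open>
Five points cannot be pairwise incongruent modulo 2. The segment between two congruent ones has
a lattice midpoint, and thus at least three lattice points, all of which belong to \<open>K\<close>; the first
three of them are consecutive.
\<close>
lemma three_collinear:
  assumes "card K = 5"
  obtains p1 p2 e1 e2 where "coprime e1 e2" "(p1, p2) \<in> K" "(p1 + e1, p2 + e2) \<in> K"
    "(p1 + 2 * e1, p2 + 2 * e2) \<in> K"
proof -
  let ?par = "\<lambda>p :: int \<times> int. (fst p mod 2, snd p mod 2)"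
  have "card (?par ` K) \<le> card ({0, 1 :: int} \<times> {0, 1 :: int})"
    by (intro card_mono) auto
  then have "card (?par ` K) < card K" using assms by simp
  then have "\<not> inj_on ?par K" by (rule pigeonhole)
  then obtain p q where pq: "p \<in> K" "q \<in> K" "p \<noteq> q" "?par p = ?par q"
    unfolding inj_on_def by blast
  obtain p1 p2 q1 q2 where [simp]: "p = (p1, p2)" "q = (q1, q2)" by (cases p, cases q) auto
  obtain d1 d2 where d: "q1 = p1 + 2 * d1" "q2 = p2 + 2 * d2"
  proof -
    have "q1 mod 2 = p1 mod 2" "q2 mod 2 = p2 mod 2" using pq(4) by simp_all
    then have "2 dvd q1 - p1" "2 dvd q2 - p2" unfolding mod_eq_dvd_iff by this
    then obtain d1 d2 where "q1 - p1 = 2 * d1" "q2 - p2 = 2 * d2" unfolding dvd_def by blast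
    then show thesis using that[of d1 d2] by linarith
  qed
  define k where "k = gcd d1 d2"
  have nz: "d1 \<noteq> 0 \<or> d2 \<noteq> 0" using pq(3) d by auto
  then have k: "k \<ge> 1" unfolding k_def
    by (metis gcd_eq_0_iff gcd_ge_0_int int_one_le_iff_zero_less order_le_less)
  obtain e1 e2 where e: "d1 = e1 * k" "d2 = e2 * k" "coprime e1 e2"
    using gcd_coprime_exists[of d1 d2] nz unfolding k_def by (metis gcd_eq_0_iff)
  have nz': "e1 \<noteq> 0 \<or> e2 \<noteq> 0" using e nz by auto
  have pt: "(p1 + j * e1, p2 + j * e2) \<in> K" if "0 \<le> j" "j \<le> 2 * k" for j
  proof (cases "j = 0 \<or> j = 2 * k")
    case True
    then show ?thesis using pq(1,2) d e by (auto simp: algebra_simps)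
  next
    case False
    then have j: "0 < j" "j < 2 * k" using that by auto
    show ?thesis
    proof (rule hull)
      show "hull3 p q q (p1 + j * e1, p2 + j * e2)"
        using j k by (intro hull3I[of "2 * k - j" j 0]) (auto simp: d e algebra_simps)
      show "(p1 + j * e1, p2 + j * e2) \<notin> {p, q, q}" using j nz' by (auto simp: d e)
    qed (use pq in auto)
  qed
  show thesis using that[of e1 e2 p1 p2] e(3) pt[of 0] pt[of 1] pt[of 2] k by simp
qed

end

section \<open>Configurations around three consecutive kernel points\<close>

text \<open>
The normal form that unimodular maps achieve. From here on \<open>K\<close> has only two points to spare.
\<close>
locale helly_config_based = helly_config +
  assumes cardV: "card V = 8" and cardK: "card K = 5"
    and base: "(-1, 0) \<in> K" "(0, 0) \<in> K" "(1, 0) \<in> K"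
begin

text \<open>
At height \<open>t\<close> the triangle over the base from \<open>(-1, 0)\<close> to \<open>(1, 0)\<close> with apex \<open>(x, h)\<close> is the
interval of length \<open>2 * (h - t) / h\<close> centred at \<open>t * x / h\<close>. The factor \<open>\<sigma>\<close> treats apexes above
and below the axis alike.
\<close>
lemma cone:
  assumes "(x, \<sigma> * h) \<in> V \<union> K" "\<sigma> \<in> {1, -1}" "0 < t" "t < h" "\<bar>h * z - t * x\<bar> \<le> h - t"
  shows "(z, \<sigma> * t) \<in> K"
proof (rule hull)
  show "hull3 (x, \<sigma> * h) (1, 0) (-1, 0) (z, \<sigma> * t)"
    using assms
    by (intro hull3I[of "2 * t" "(h - t) + (h * z - t * x)" "(h - t) - (h * z - t * x)"])
      (auto simp: algebra_simps)
qed (use assms base in auto)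

text \<open>
The lattice points that such a triangle certainly contains. Unless \<open>h\<close> divides \<open>x\<close> there are two
at height 1, and when \<open>h \<ge> 3\<close> also one at height 2, which together exceed what \<open>K\<close> has to spare.
If \<open>h\<close> divides \<open>x\<close>, the lattice points on the line from the origin to the apex are in \<open>K\<close>.
\<close>
lemma apex:
  assumes "(x, \<sigma> * h) \<in> V \<union> K" "\<sigma> \<in> {1, -1}" "h \<ge> 2"
  shows "(x div h, \<sigma>) \<in> K"
    and "x mod h \<noteq> 0 \<Longrightarrow> (x div h + 1, \<sigma>) \<in> K"
    and "x mod h \<noteq> 0 \<Longrightarrow> h \<ge> 3 \<Longrightarrow> (2 * (x div h) + 1, \<sigma> * 2) \<in> K"
    and "x mod h = 0 \<Longrightarrow> 0 < t \<Longrightarrow> t < h \<Longrightarrow> (t * (x div h), \<sigma> * t) \<in> K"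
proof -
  define a r where "a = x div h" and "r = x mod h"
  have x: "x = h * a + r" unfolding a_def r_def by simp
  have r: "0 \<le> r" "r < h" using assms(3) unfolding r_def by auto
  show "(x div h, \<sigma>) \<in> K"
    using cone[of x \<sigma> h 1 "x div h"] assms r unfolding a_def[symmetric] by (simp add: x)
  show "(x div h + 1, \<sigma>) \<in> K" if "x mod h \<noteq> 0"
    using cone[of x \<sigma> h 1 "a + 1"] assms r that unfolding a_def[symmetric] r_def[symmetric]
    by (simp add: x algebra_simps)
  show "(2 * (x div h) + 1, \<sigma> * 2) \<in> K" if "x mod h \<noteq> 0" "h \<ge> 3"
    using cone[of x \<sigma> h 2 "2 * a + 1"] assms r that unfolding a_def[symmetric] r_def[symmetric]
    by (simp add: x algebra_simps)
  show "(t * (x div h), \<sigma> * t) \<in> K" if "x mod h = 0" "0 < t" "t < h"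
    using cone[of x \<sigma> h t "t * a"] assms r that unfolding a_def[symmetric] r_def[symmetric]
    by (simp add: x algebra_simps)
qed

text \<open>
A vertex \<open>(x, 0)\<close> lies outside the base, thus \<open>\<bar>x\<bar> \<ge> 2\<close>. The triangle that it forms with the origin
and the apex has at height 1 a width of at least 1, measured from \<open>(a, 1)\<close> towards \<open>x\<close>.
\<close>
lemma flank:
  assumes "(h * a, h) \<in> V \<union> K" "h \<ge> 2" "(x, 0) \<in> V"
  shows "(a + 1, 1) \<in> K \<or> (a - 1, 1) \<in> K"
proof -
  have "x \<noteq> -1" "x \<noteq> 0" "x \<noteq> 1" using base disj assms(3) by auto
  then consider "x \<ge> 2" | "x \<le> -2" by linarith
  then show ?thesis
  proof cases
    case 1
    have "2 * (h - 1) \<le> x * (h - 1)" using 1 assms(2) by (intro mult_right_mono) auto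
    moreover have "h \<le> 2 * (h - 1)" using assms(2) by simp
    ultimately have "h \<le> x * (h - 1)" by (rule order_trans[rotated])
    then have "hull3 (h * a, h) (x, 0) (0, 0) (a + 1, 1)"
      using 1 assms(2) by (intro hull3I[of x h "x * (h - 1) - h"]) (auto simp: algebra_simps)
    then show ?thesis using hull[of "(h * a, h)" "(x, 0)" "(0, 0)" "(a + 1, 1)"] base assms by auto
  next
    case 2
    have "2 * (h - 1) \<le> (- x) * (h - 1)" using 2 assms(2) by (intro mult_right_mono) auto
    moreover have "h \<le> 2 * (h - 1)" using assms(2) by simp
    ultimately have "h \<le> (- x) * (h - 1)" by (rule order_trans[rotated])
    then have "hull3 (h * a, h) (x, 0) (0, 0) (a - 1, 1)"
      using 2 assms(2) by (intro hull3I[of "- x" h "(- x) * (h - 1) - h"]) (auto simp: algebra_simps)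
    then show ?thesis using hull[of "(h * a, h)" "(x, 0)" "(0, 0)" "(a - 1, 1)"] base assms by auto
  qed
qed

lemma kernel_determined:
  assumes "p \<in> K" "q \<in> K" "p \<noteq> q" "snd p \<noteq> 0" "snd q \<noteq> 0"
  shows "K = {(-1, 0), (0, 0), (1, 0), p, q}"
proof -
  have "card {(-1, 0), (0, 0), (1, 0), p, q} = 5" using assms by (auto simp: card_insert_if)
  then show ?thesis
    using card_subset_eq[OF finK, of "{(-1, 0), (0, 0), (1, 0), p, q}"] assms base cardK by auto
qed

lemma card_rows_le:
  assumes "V \<subseteq> {v. snd v \<in> R} \<union> T" "finite R" "finite T"
  shows "card V \<le> 2 * card R + card T"
proof -
  have "V \<subseteq> (\<Union>y\<in>R. {v \<in> V. snd v = y}) \<union> T" using assms(1) by auto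
  then have "card V \<le> card ((\<Union>y\<in>R. {v \<in> V. snd v = y}) \<union> T)"
    using finV assms by (intro card_mono) auto
  also have "\<dots> \<le> card (\<Union>y\<in>R. {v \<in> V. snd v = y}) + card T" by (rule card_Un_le)
  also have "card (\<Union>y\<in>R. {v \<in> V. snd v = y}) \<le> (\<Sum>y\<in>R. card {v \<in> V. snd v = y})"
    by (rule card_UN_le[OF assms(2)])
  also have "\<dots> \<le> (\<Sum>y\<in>R. 2)" by (intro sum_mono card_row_le)
  finally show ?thesis by simp
qed

text \<open>
By \<open>four_rows\<close> there is a point at height at least 3. Only an apex \<open>(3 * a, 3)\<close> is compatible with
the two points that \<open>K\<close> has off the axis, and it determines them. With at most seven vertices in the
rows -1, 1, 2 and 3, there is one on the axis, to which \<open>flank\<close> applies.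
\<close>
lemma one_sided:
  assumes low: "\<And>s. s \<in> V \<union> K \<Longrightarrow> snd s \<ge> -1"
  shows False
proof -
  have "\<exists>s \<in> V \<union> K. snd s \<ge> 3"
  proof (rule ccontr)
    assume "\<not> ?thesis"
    then have "\<not> snd s \<ge> 3" if "s \<in> V \<union> K" for s using that by blast
    then have "snd s \<in> {-1..2}" if "s \<in> V \<union> K" for s using low[OF that] that by fastforce
    then show False using four_rows cardV cardK by blast
  qed
  then obtain x h where top: "(x, h) \<in> V \<union> K" "h \<ge> 3" by force
  have tall: "x' mod h' = 0 \<and> h' = 3 \<and> K = {(-1, 0), (0, 0), (1, 0), (x' div h', 1), (2 * (x' div h'), 2)}"
    if s: "(x', h') \<in> V \<union> K" "h' \<ge> 3" for x' h'
  proof -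
    have "(x', 1 * h') \<in> V \<union> K" "h' \<ge> 2" using s by simp_all
    note ap = apex[OF this(1) _ this(2), simplified]
    have m: "x' mod h' = 0"
    proof (rule ccontr)
      assume n: "x' mod h' \<noteq> 0"
      have "K = {(-1, 0), (0, 0), (1, 0), (x' div h', 1), (x' div h' + 1, 1)}"
        using ap n s by (intro kernel_determined) auto
      moreover have "(2 * (x' div h') + 1, 2) \<in> K" using ap n s by auto
      ultimately show False by auto
    qed
    have K: "K = {(-1, 0), (0, 0), (1, 0), (x' div h', 1), (2 * (x' div h'), 2)}"
      using ap(4)[of 1] ap(4)[of 2] m s by (intro kernel_determined) auto
    have "h' = 3"
    proof (rule ccontr)
      assume "h' \<noteq> 3"
      then have "(3 * (x' div h'), 3) \<in> K" using ap(4)[of 3] m s by auto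
      then show False unfolding K by auto
    qed
    then show ?thesis using m K by simp
  qed
  define a where "a = x div h"
  have h: "h = 3" and K: "K = {(-1, 0), (0, 0), (1, 0), (a, 1), (2 * a, 2)}"
    using tall[OF top] unfolding a_def by auto
  have uniq: "x' = 3 * a \<and> h' = 3" if "(x', h') \<in> V \<union> K" "h' \<ge> 3" for x' h'
  proof -
    have "h' = 3" "x' mod 3 = 0" "(x' div 3, 1) \<in> K" using tall[OF that] by auto
    then have "x' div 3 = a" unfolding K by auto
    then show ?thesis using \<open>h' = 3\<close> \<open>x' mod 3 = 0\<close> by auto
  qed
  have "\<exists>w. (w, 0) \<in> V"
  proof (rule ccontr)
    assume none: "\<nexists>w. (w, 0) \<in> V"
    have "V \<subseteq> {v. snd v \<in> {-1, 1, 2}} \<union> {(3 * a, 3)}"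
    proof
      fix v assume v: "v \<in> V"
      obtain p q where pq: "v = (p, q)" by (cases v)
      have "q \<ge> -1" "q \<noteq> 0" using low[of v] none v pq by auto
      then have "q = -1 \<or> q = 1 \<or> q = 2 \<or> q \<ge> 3" by linarith
      then show "v \<in> {v. snd v \<in> {-1, 1, 2}} \<union> {(3 * a, 3)}"
        using uniq[of p q] v pq by auto
    qed
    from card_rows_le[OF this] show False using cardV by simp
  qed
  then obtain w where "(w, 0) \<in> V" by blast
  moreover have "(3 * a, 3) \<in> V \<union> K" using uniq[OF top] top by auto
  ultimately have "(a + 1, 1) \<in> K \<or> (a - 1, 1) \<in> K" using flank[of 3 a w] by auto
  then show False unfolding K by auto
qed

text \<open>
One point of \<open>K\<close> is at height 1 and one at height -1, which leaves only one possible apex on each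
side, at height 2 and -2. So the rows off the axis have at most six vertices, and \<open>flank\<close> applies
to a vertex on the axis.
\<close>
lemma two_sided:
  assumes top: "(x, h) \<in> V \<union> K" "h \<ge> 2" and bot: "(x', - h') \<in> V \<union> K" "h' \<ge> 2"
  shows False
proof -
  define a c where "a = x div h" and "c = x' div h'"
  have K: "K = {(-1, 0), (0, 0), (1, 0), (a, 1), (c, -1)}"
    using apex(1)[of x 1 h] apex(1)[of x' "-1" h'] top bot unfolding a_def c_def
    by (intro kernel_determined) auto
  have tip: "q = 2 \<and> (\<exists>d. p = 2 * d \<and> (d, \<sigma>) \<in> K)"
    if s: "(p, \<sigma> * q) \<in> V \<union> K" "q \<ge> 2" "\<sigma> \<in> {1, -1}" for p q \<sigma>
  proof -
    note ap = apex[of p \<sigma> q, OF s(1,3,2)]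
    have m: "p mod q = 0"
    proof (rule ccontr)
      assume "p mod q \<noteq> 0"
      from ap(1) ap(2)[OF this] s(3) show False unfolding K by auto
    qed
    have "q = 2"
    proof (rule ccontr)
      assume "q \<noteq> 2"
      then have "(2 * (p div q), \<sigma> * 2) \<in> K" using ap(4)[of 2] m s by auto
      then show False using s(3) unfolding K by auto
    qed
    moreover have "p = q * (p div q)" using m by auto
    ultimately show ?thesis using ap(1) by metis
  qed
  have up: "p = 2 * a \<and> q = 2" if "(p, q) \<in> V \<union> K" "q \<ge> 2" for p q
    using tip[of p 1 q] that unfolding K by auto
  have down: "p = 2 * c \<and> q = -2" if "(p, q) \<in> V \<union> K" "q \<le> -2" for p q
    using tip[of p "-1" "-q"] that unfolding K by auto
  have "\<exists>w. (w, 0) \<in> V"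
  proof (rule ccontr)
    assume none: "\<nexists>w. (w, 0) \<in> V"
    have "V \<subseteq> {v. snd v \<in> {-1, 1}} \<union> {(2 * a, 2), (2 * c, -2)}"
    proof
      fix v assume v: "v \<in> V"
      obtain p q where pq: "v = (p, q)" by (cases v)
      have "q \<noteq> 0" using none v pq by auto
      then have "q = -1 \<or> q = 1 \<or> q \<ge> 2 \<or> q \<le> -2" by linarith
      then show "v \<in> {v. snd v \<in> {-1, 1}} \<union> {(2 * a, 2), (2 * c, -2)}"
        using up[of p q] down[of p q] v pq by auto
    qed
    from card_rows_le[OF this] show False using cardV by simp
  qed
  then obtain w where "(w, 0) \<in> V" by blast
  moreover have "(2 * a, 2) \<in> V \<union> K" using up[OF top] top by auto
  ultimately have "(a + 1, 1) \<in> K \<or> (a - 1, 1) \<in> K" using flank[of 2 a w] by auto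
  then show False unfolding K by auto
qed

end

lemma (in helly_config_based) impossible: False
proof (cases "\<exists>s \<in> V \<union> K. snd s \<le> -2")
  case False
  then have "snd s \<ge> -1" if "s \<in> V \<union> K" for s using that by force
  then show False by (rule one_sided)
next
  case True
  then obtain x' h' where bot: "(x', - h') \<in> V \<union> K" "h' \<ge> 2"
    by (metis add.inverse_inverse le_minus_iff prod.collapse)
  show False
  proof (cases "\<exists>s \<in> V \<union> K. snd s \<ge> 2")
    case True
    then obtain x h where "(x, h) \<in> V \<union> K" "h \<ge> 2" by force
    then show False using two_sided bot by blast
  next
    case False
    define g :: "int \<times> int \<Rightarrow> int \<times> int" where "g = (\<lambda>(x, y). (x, - y))"
    have g: "g (g p) = p" for p unfolding g_def by (auto split: prod.splits)
    have ga: "g (x, y) = (1 * x + 0 * y + 0, 0 * x + (-1) * y + 0)" for x y unfolding g_def by simp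
    have inj: "inj g" using g by (metis injI)
    interpret R: helly_config "g ` V" "g ` K" by (rule affine_image[OF ga ga g g])
    interpret R: helly_config_based "g ` V" "g ` K"
    proof
      show "card (g ` V) = 8" "card (g ` K) = 5"
        using cardV cardK by (simp_all add: card_image inj_on_subset[OF inj])
      have "g (-1, 0) = (-1, 0)" "g (0, 0) = (0, 0)" "g (1, 0) = (1, 0)" unfolding g_def by simp_all
      then show "(-1, 0) \<in> g ` K" "(0, 0) \<in> g ` K" "(1, 0) \<in> g ` K"
        using base by (metis imageI)+
    qed
    have "snd s \<ge> -1" if "s \<in> g ` V \<union> g ` K" for s
      using that False unfolding g_def by force
    then show False by (rule R.one_sided)
  qed
qed

lemma (in helly_config) card_8_5_impossible:
  assumes "card V = 8" "card K = 5"
  shows False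
proof -
  obtain p1 p2 e1 e2 where e: "coprime e1 e2" "(p1, p2) \<in> K" "(p1 + e1, p2 + e2) \<in> K"
    "(p1 + 2 * e1, p2 + 2 * e2) \<in> K"
    by (rule three_collinear[OF assms(2)])
  obtain u v where "u * e1 + v * e2 = gcd e1 e2"
    using bezout_int[of e1 e2] by blast
  then have uv: "u * e1 + v * e2 = 1" using coprime_imp_gcd_eq_1[OF e(1)] by simp
  define q1 q2 where "q1 = p1 + e1" and "q2 = p2 + e2"
  define g where "g = (\<lambda>(x, y). (u * (x - q1) + v * (y - q2), e1 * (y - q2) - e2 * (x - q1)))"
  define g' where "g' = (\<lambda>(X, Y). (q1 + e1 * X - v * Y, q2 + e2 * X + u * Y))"
  have ga: "g (x, y) = (u * x + v * y + (- u * q1 - v * q2), - e2 * x + e1 * y + (e2 * q1 - e1 * q2))"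
    for x y unfolding g_def by (simp add: algebra_simps)
  have ga': "g' (x, y) = (e1 * x + (- v) * y + q1, e2 * x + u * y + q2)"
    for x y unfolding g'_def by (simp add: algebra_simps)
  have gg': "g (g' p) = p" for p
  proof (cases p)
    case (Pair X Y)
    have "u * (e1 * X - v * Y) + v * (e2 * X + u * Y) = (u * e1 + v * e2) * X"
      "e1 * (e2 * X + u * Y) - e2 * (e1 * X - v * Y) = (u * e1 + v * e2) * Y"
      by (simp_all add: algebra_simps)
    then show ?thesis unfolding g_def g'_def uv Pair by simp
  qed
  have g'g: "g' (g p) = p" for p
  proof (cases p)
    case (Pair x y)
    have "e1 * (u * (x - q1) + v * (y - q2)) - v * (e1 * (y - q2) - e2 * (x - q1))
        = (u * e1 + v * e2) * (x - q1)"
      "e2 * (u * (x - q1) + v * (y - q2)) + u * (e1 * (y - q2) - e2 * (x - q1))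
        = (u * e1 + v * e2) * (y - q2)"
      by (simp_all add: algebra_simps)
    then have "q1 + e1 * fst (g p) - v * snd (g p) = x" "q2 + e2 * fst (g p) + u * snd (g p) = y"
      unfolding uv g_def Pair by simp_all
    then show ?thesis unfolding g'_def Pair by (simp add: case_prod_beta)
  qed
  have inj: "inj g" using g'g by (metis injI)
  interpret N: helly_config "g ` V" "g ` K" by (rule affine_image[OF ga ga' gg' g'g])
  have img: "g (p1, p2) = (-1, 0)" "g (p1 + e1, p2 + e2) = (0, 0)" "g (p1 + 2 * e1, p2 + 2 * e2) = (1, 0)"
    using uv unfolding g_def q1_def q2_def by (auto simp: algebra_simps)
  interpret N: helly_config_based "g ` V" "g ` K"
  proof
    show "card (g ` V) = 8" "card (g ` K) = 5"
      using assms by (simp_all add: card_image inj_on_subset[OF inj])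
    show "(-1, 0) \<in> g ` K" "(0, 0) \<in> g ` K" "(1, 0) \<in> g ` K"
      using e(2-4) img by (metis imageI)+
  qed
  show False by (rule N.impossible)
qed

text \<open>
If there are more than 12 points, keep eight vertices and move as many others from \<open>V\<close> to \<open>K\<close> as are
missing from five; the assumptions on a configuration survive this, and surplus vertices can be
discarded.
\<close>
lemma (in helly_config) card_sum_le_12:
  assumes "card K \<le> 5"
  shows "card V + card K \<le> 12"
proof (rule ccontr)
  assume "\<not> card V + card K \<le> 12"
  then have big: "card V + card K \<ge> 13" by simp
  then have "5 - card K \<le> card V" using assms by linarith
  then obtain T where T: "T \<subseteq> V" "card T = 5 - card K" "finite T"
    by (rule obtain_subset_with_card_n)
  have "card (V - T) = card V - (5 - card K)" using T by (simp add: card_Diff_subset)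
  then have "8 \<le> card (V - T)" using big assms by linarith
  then obtain V' where V': "V' \<subseteq> V - T" "card V' = 8" "finite V'"
    by (rule obtain_subset_with_card_n)
  interpret T: helly_config V' "K \<union> T"
  proof
    fix s t u p
    assume "s \<in> V' \<union> (K \<union> T)" "t \<in> V' \<union> (K \<union> T)" "u \<in> V' \<union> (K \<union> T)"
      and h: "hull3 s t u p" "p \<notin> {s, t, u}"
    then have "s \<in> V \<union> K" "t \<in> V \<union> K" "u \<in> V \<union> K" using V'(1) T(1) by auto
    then show "p \<in> K \<union> T" using hull h by blast
  qed (use V' T disj finK in auto)
  have "K \<inter> T = {}" using T(1) disj by auto
  then have "card (K \<union> T) = 5" using T assms finK by (simp add: card_Un_disjoint)
  then show False by (rule T.card_8_5_impossible[OF V'(2)])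
qed

section \<open>Irredundant systems give configurations\<close>

text \<open>
The strict version is what makes a point exposed: if the linear form attains its bound at no more
than one corner, it stays below the bound at every lattice point that is not a corner.
\<close>
lemma hull3_le:
  fixes a b c :: real
  assumes "hull3 s t u p" "\<And>q. q \<in> {s, t, u} \<Longrightarrow> a * fst q + b * snd q \<le> c"
  shows "a * fst p + b * snd p \<le> c"
    and "\<lbrakk>p \<notin> {s, t, u}; \<And>q r. \<lbrakk>q \<in> {s, t, u}; r \<in> {s, t, u};
        a * fst q + b * snd q = c; a * fst r + b * snd r = c\<rbrakk> \<Longrightarrow> q = r\<rbrakk>
      \<Longrightarrow> a * fst p + b * snd p < c"
proof -
  define f where "f q = a * fst q + b * snd q" for q :: "int \<times> int"
  obtain \<alpha> \<beta> \<gamma> where w: "\<alpha> \<ge> 0" "\<beta> \<ge> 0" "\<gamma> \<ge> 0" "\<alpha> + \<beta> + \<gamma> > 0"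
    and p: "(\<alpha> + \<beta> + \<gamma>) * fst p = \<alpha> * fst s + \<beta> * fst t + \<gamma> * fst u"
    "(\<alpha> + \<beta> + \<gamma>) * snd p = \<alpha> * snd s + \<beta> * snd t + \<gamma> * snd u"
    using assms(1) unfolding hull3_def by blast
  define n where "n = \<alpha> + \<beta> + \<gamma>"
  have "real_of_int n * f p = a * real_of_int (n * fst p) + b * real_of_int (n * snd p)"
    unfolding f_def by (simp add: algebra_simps)
  also have "\<dots> = \<alpha> * f s + \<beta> * f t + \<gamma> * f u"
    unfolding n_def p f_def by (simp add: algebra_simps)
  finally have fp: "n * (c - f p) = \<alpha> * (c - f s) + \<beta> * (c - f t) + \<gamma> * (c - f u)"
    unfolding n_def by (simp add: algebra_simps)
  have nn: "c - f s \<ge> 0" "c - f t \<ge> 0" "c - f u \<ge> 0" using assms(2) unfolding f_def by auto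
  have n: "real_of_int n > 0" using w unfolding n_def by linarith
  have terms: "\<alpha> * (c - f s) \<ge> 0" "\<beta> * (c - f t) \<ge> 0" "\<gamma> * (c - f u) \<ge> 0" using nn w by auto
  then have "n * (c - f p) \<ge> 0" using fp by simp
  then have le: "f p \<le> c" using n by (simp add: zero_le_mult_iff)
  then show "a * fst p + b * snd p \<le> c" unfolding f_def .
  assume notin: "p \<notin> {s, t, u}"
    and uniq: "\<And>q r. \<lbrakk>q \<in> {s, t, u}; r \<in> {s, t, u};
        a * fst q + b * snd q = c; a * fst r + b * snd r = c\<rbrakk> \<Longrightarrow> q = r"
  have "f p \<noteq> c"
  proof
    assume "f p = c"
    then have "real_of_int n * (c - f p) = 0" by simp
    then have "\<alpha> * (c - f s) = 0" "\<beta> * (c - f t) = 0" "\<gamma> * (c - f u) = 0"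
      using fp terms by linarith+
    then have z: "\<alpha> = 0 \<or> f s = c" "\<beta> = 0 \<or> f t = c" "\<gamma> = 0 \<or> f u = c" by auto
    have "\<alpha> \<noteq> 0 \<or> \<beta> \<noteq> 0 \<or> \<gamma> \<noteq> 0" using w by auto
    then obtain q where q: "q \<in> {s, t, u}" "f q = c" using z by blast
    have "\<alpha> = 0 \<or> s = q" "\<beta> = 0 \<or> t = q" "\<gamma> = 0 \<or> u = q"
      using z uniq q unfolding f_def by blast+
    then have eqs: "\<alpha> * fst s = \<alpha> * fst q" "\<beta> * fst t = \<beta> * fst q" "\<gamma> * fst u = \<gamma> * fst q"
      "\<alpha> * snd s = \<alpha> * snd q" "\<beta> * snd t = \<beta> * snd q" "\<gamma> * snd u = \<gamma> * snd q" by auto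
    then have "n * fst p = n * fst q" "n * snd p = n * snd q"
      unfolding n_def p eqs by (simp_all only: distrib_right)
    then have "p = q" using n by (simp add: prod_eq_iff)
    then show False using q notin by blast
  qed
  then show "a * fst p + b * snd p < c" using le unfolding f_def by simp
qed

text \<open>
The rows are relaxed one by one: for row \<open>i\<close>, choose \<open>v i\<close> with the least value \<open>f i (v i) > b i\<close>
among the points that satisfy all other constraints in their current form, and replace the
constraint by \<open>f i x < f i (v i)\<close>. By minimality this admits no new point. As later steps only weaken
constraints, an earlier \<open>v j\<close> still satisfies them. The finite set \<open>Q\<close> guarantees that
the minimum exists.
\<close>
lemma tight_witnesses:
  fixes f :: "'i \<Rightarrow> 'q \<Rightarrow> real" and b :: "'i \<Rightarrow> real"
  assumes "finite I" "finite Q"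
    and irred: "\<And>i. i \<in> I \<Longrightarrow> \<exists>w \<in> Q. f i w > b i \<and> (\<forall>j \<in> I - {i}. f j w \<le> b j)"
  shows "\<exists>v. (\<forall>i \<in> I. v i \<in> Q \<and> b i < f i (v i)) \<and>
    (\<forall>i \<in> I. \<forall>j \<in> I. j \<noteq> i \<longrightarrow> f j (v i) < f j (v j)) \<and>
    (\<forall>x \<in> Q. (\<forall>i \<in> I. f i x < f i (v i)) \<longrightarrow> (\<forall>i \<in> I. f i x \<le> b i))"
proof -
  define ok where "ok J v \<longleftrightarrow> (\<forall>i \<in> J. v i \<in> Q \<and> b i < f i (v i) \<and>
      (\<forall>j \<in> J - {i}. f j (v i) < f j (v j)) \<and> (\<forall>j \<in> I - J. f j (v i) \<le> b j)) \<and>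
    (\<forall>x \<in> Q. (\<forall>i \<in> J. f i x < f i (v i)) \<and> (\<forall>i \<in> I - J. f i x \<le> b i) \<longrightarrow> (\<forall>i \<in> I. f i x \<le> b i))"
    for J v
  have "\<exists>v. ok J v" if "finite J" "J \<subseteq> I" for J
    using that
  proof (induction J)
    case empty
    then show ?case unfolding ok_def by auto
  next
    case (insert i J)
    then obtain v where v: "ok J v" by auto
    define C where "C = {x \<in> Q. f i x > b i \<and> (\<forall>j \<in> J. f j x < f j (v j))
      \<and> (\<forall>j \<in> I - insert i J. f j x \<le> b j)}"
    obtain w where w: "w \<in> Q" "f i w > b i" "\<forall>j \<in> I - {i}. f j w \<le> b j"
      using irred[of i] insert.prems by auto
    have "f j w < f j (v j)" if "j \<in> J" for j
    proof -
      have "f j w \<le> b j" using w(3) that insert by auto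
      also have "b j < f j (v j)" using v that unfolding ok_def by blast
      finally show ?thesis .
    qed
    then have "w \<in> C" using w unfolding C_def by auto
    moreover have "finite C" using assms(2) unfolding C_def by simp
    ultimately obtain z where z: "z \<in> C" and zmin: "\<And>x. x \<in> C \<Longrightarrow> f i z \<le> f i x"
      using ex_min_if_finite[of "f i ` C"] by (metis arg_min_if_finite(1) arg_min_least empty_iff)
    have "ok (insert i J) (v(i := z))"
      unfolding ok_def
    proof (intro conjI ballI impI)
      fix k assume k: "k \<in> insert i J"
      show "(v(i := z)) k \<in> Q" "b k < f k ((v(i := z)) k)"
        using k z v unfolding ok_def C_def by auto
      show "f j ((v(i := z)) k) \<le> b j" if "j \<in> I - insert i J" for j
        using that k z v unfolding ok_def C_def by auto
      show "f j ((v(i := z)) k) < f j ((v(i := z)) j)" if j: "j \<in> insert i J - {k}" for j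
      proof (cases "j = i")
        case True
        then have "k \<in> J" "i \<in> I - J" using k j insert.hyps insert.prems by auto
        then have "f i (v k) \<le> b i" using v unfolding ok_def by blast
        also have "b i < f i z" using z unfolding C_def by auto
        finally show ?thesis using True j by auto
      next
        case False
        then show ?thesis using k j v z insert.hyps unfolding ok_def C_def by auto
      qed
    next
      fix x k assume x: "x \<in> Q" "k \<in> I"
        and *: "(\<forall>k\<in>insert i J. f k x < f k ((v(i := z)) k)) \<and> (\<forall>k\<in>I - insert i J. f k x \<le> b k)"
      then have xi: "f i x < f i z" and xJ: "\<forall>j\<in>J. f j x < f j (v j)"
        using insert.hyps(2) by (simp, metis fun_upd_apply insertCI)
      have "f i x \<le> b i"
      proof (rule ccontr)
        assume "\<not> f i x \<le> b i"
        then have "x \<in> C" using x * xJ unfolding C_def by auto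
        then show False using zmin[of x] xi by simp
      qed
      then have "\<forall>k \<in> I - J. f k x \<le> b k" using * by auto
      then show "f k x \<le> b k" using v x xJ unfolding ok_def by blast
    qed
    then show ?case by blast
  qed
  then obtain v where "ok I v" using assms(1) by blast
  then show ?thesis unfolding ok_def by (intro exI[of _ v]) auto
qed

lemma finite_subset_box:
  assumes "finite (F :: (int \<times> int) set)"
  obtains M where "F \<subseteq> {-M..M} \<times> {-M..M}"
proof -
  define M where "M = Max (insert 0 ((\<lambda>p. max \<bar>fst p\<bar> \<bar>snd p\<bar>) ` F))"
  have "max \<bar>fst p\<bar> \<bar>snd p\<bar> \<le> M" if "p \<in> F" for p
    unfolding M_def using assms that by (intro Max_ge) auto
  then have "F \<subseteq> {-M..M} \<times> {-M..M}" by (fastforce simp: abs_le_iff)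
  then show thesis by (rule that)
qed

definition planar_solutions :: "(nat \<Rightarrow> real) \<Rightarrow> (nat \<Rightarrow> real) \<Rightarrow> (nat \<Rightarrow> real) \<Rightarrow> nat set \<Rightarrow> (int \<times> int) set" where
  "planar_solutions a a' b I = {p. \<forall>i \<in> I. a i * real_of_int (fst p) + a' i * real_of_int (snd p) \<le> b i}"

text \<open>
\<open>Q\<close> is a box around the solutions and one witness per row, which is finite and convex; so
triangles with corners in it do not leave the region where \<open>tight_witnesses\<close> controls the solutions.
\<close>
lemma irredundant_config:
  assumes "finite I" and fin: "finite (planar_solutions a a' b I)"
    and irred: "\<And>i. i \<in> I \<Longrightarrow> planar_solutions a a' b (I - {i}) \<noteq> planar_solutions a a' b I"
  obtains V where "helly_config V (planar_solutions a a' b I)" "card V = card I"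
proof -
  define f where "f i p = a i * fst p + a' i * snd p" for i and p :: "int \<times> int"
  define X where "X = planar_solutions a a' b I"
  have X: "X = {p. \<forall>i \<in> I. f i p \<le> b i}" unfolding X_def planar_solutions_def f_def by simp
  have "\<exists>w. f i w > b i \<and> (\<forall>j \<in> I - {i}. f j w \<le> b j)" if "i \<in> I" for i
  proof -
    have "X \<subseteq> planar_solutions a a' b (I - {i})" unfolding X_def planar_solutions_def by auto
    then obtain z where z: "z \<in> planar_solutions a a' b (I - {i})" "z \<notin> X"
      using irred[OF \<open>i \<in> I\<close>] unfolding X_def by blast
    have "\<forall>j \<in> I - {i}. f j z \<le> b j"
      using z(1) unfolding planar_solutions_def f_def by simp
    moreover from this have "\<not> f i z \<le> b i" using z(2) unfolding X by blast
    ultimately show ?thesis by (intro exI[of _ z]) simp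
  qed
  then obtain w where w: "\<And>i. i \<in> I \<Longrightarrow> f i (w i) > b i \<and> (\<forall>j \<in> I - {i}. f j (w i) \<le> b j)"
    by metis
  have "finite (X \<union> w ` I)" using assms(1) fin unfolding X_def by simp
  then obtain M where M: "X \<union> w ` I \<subseteq> {-M..M} \<times> {-M..M}" by (rule finite_subset_box)
  define Q where "Q = {-M..M} \<times> {-M..M}"
  have "finite Q" unfolding Q_def by simp
  have in_box: "\<exists>w \<in> Q. f i w > b i \<and> (\<forall>j \<in> I - {i}. f j w \<le> b j)" if "i \<in> I" for i
    using w[OF that] M that unfolding Q_def by blast
  obtain v where v: "\<And>i. i \<in> I \<Longrightarrow> v i \<in> Q" "\<And>i. i \<in> I \<Longrightarrow> b i < f i (v i)"
    "\<And>i j. i \<in> I \<Longrightarrow> j \<in> I \<Longrightarrow> j \<noteq> i \<Longrightarrow> f j (v i) < f j (v j)"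
    "\<forall>x \<in> Q. (\<forall>i \<in> I. f i x < f i (v i)) \<longrightarrow> (\<forall>i \<in> I. f i x \<le> b i)"
    using tight_witnesses[where f = f and b = b, OF assms(1) \<open>finite Q\<close> in_box] by auto
  have top: "q = v i \<or> f i q < f i (v i)" if "q \<in> v ` I \<union> X" "i \<in> I" for q i
    using that v(2,3)[of i] v(3) unfolding X by force
  have "inj_on v I" using v(3) by (metis inj_onI less_irrefl)
  moreover have "helly_config (v ` I) X"
  proof
    show "v ` I \<inter> X = {}" using v(2) unfolding X by force
    fix s t u p
    assume stu: "s \<in> v ` I \<union> X" "t \<in> v ` I \<union> X" "u \<in> v ` I \<union> X"
      and h: "hull3 s t u p" and p: "p \<notin> {s, t, u}"
    have inQ: "q \<in> Q" if "q \<in> {s, t, u}" for q using that stu v(1) M unfolding Q_def by blast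
    have "p \<in> Q"
      using hull3_le(1)[OF h, of 1 0 M] hull3_le(1)[OF h, of "-1" 0 M]
        hull3_le(1)[OF h, of 0 1 M] hull3_le(1)[OF h, of 0 "-1" M] inQ
      unfolding Q_def by (force simp: mem_Times_iff)
    moreover have "f i p < f i (v i)" if i: "i \<in> I" for i
      unfolding f_def
    proof (rule hull3_le(2)[OF h _ p])
      show "a i * fst q + a' i * snd q \<le> a i * fst (v i) + a' i * snd (v i)" if "q \<in> {s, t, u}" for q
        using top[OF _ i, of q] that stu unfolding f_def by auto
      show "q = r" if "q \<in> {s, t, u}" "r \<in> {s, t, u}"
        "a i * fst q + a' i * snd q = a i * fst (v i) + a' i * snd (v i)"
        "a i * fst r + a' i * snd r = a i * fst (v i) + a' i * snd (v i)" for q r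
        using top[OF _ i, of q] top[OF _ i, of r] that stu unfolding f_def by auto
    qed
    ultimately show "p \<in> X" using v(4) unfolding X by blast
  qed (use assms(1) fin X_def in auto)
  ultimately show thesis using that[of "v ` I"] unfolding X_def by (simp add: card_image)
qed

section \<open>The bounds\<close>

definition point_vec :: "int \<times> int \<Rightarrow> real vec" where
  "point_vec p = vec 2 (\<lambda>i. if i = 0 then real_of_int (fst p) else real_of_int (snd p))"

lemma inj_point_vec: "inj point_vec"
proof (rule injI)
  fix p q assume "point_vec p = point_vec q"
  then have "point_vec p $ 0 = point_vec q $ 0" "point_vec p $ 1 = point_vec q $ 1" by simp_all
  then show "p = q" unfolding point_vec_def by (simp add: prod_eq_iff)
qed

lemma integer_vecs_2: "integer_vecs 2 = range point_vec"
proof (intro equalityI subsetI)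
  fix x assume "x \<in> integer_vecs 2"
  then have x: "x \<in> carrier_vec 2" "x $ 0 \<in> \<int>" "x $ 1 \<in> \<int>" unfolding integer_vecs_def by auto
  then obtain m n where mn: "x $ 0 = of_int m" "x $ 1 = of_int n" by (auto elim!: Ints_cases)
  have "x = point_vec (m, n)"
    using x(1) mn unfolding point_vec_def by (intro eq_vecI) (auto simp: less_2_cases_iff)
  then show "x \<in> range point_vec" by simp
next
  fix x assume "x \<in> range point_vec"
  then show "x \<in> integer_vecs 2" unfolding integer_vecs_def point_vec_def by auto
qed

lemma rows_polyhedron_integer:
  assumes "A \<in> carrier_mat m 2" "I \<subseteq> {..<m}"
  shows "rows_polyhedron A b I \<inter> integer_vecs 2
    = point_vec ` planar_solutions (\<lambda>i. A $$ (i, 0)) (\<lambda>i. A $$ (i, 1)) (\<lambda>i. b $ i) I"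
proof -
  have "row A i \<bullet> point_vec p
      = A $$ (i, 0) * real_of_int (fst p) + A $$ (i, 1) * real_of_int (snd p)" if "i \<in> I" for i p
    using assms that unfolding scalar_prod_def point_vec_def by (auto simp: numeral_2_eq_2)
  moreover have "point_vec p \<in> carrier_vec (dim_col A)" for p
    using assms unfolding point_vec_def by auto
  ultimately show ?thesis
    unfolding integer_vecs_2 rows_polyhedron_def planar_solutions_def by auto
qed

lemma helly_bound_upper:
  assumes "k \<le> 5"
  shows "helly_bound 2 k (12 - int k)"
  unfolding helly_bound_def
proof (intro allI ballI impI)
  fix m A and b :: "real vec"
  assume A: "A \<in> carrier_mat m 2" and "b \<in> carrier_vec m"
    and fk: "finite (rows_polyhedron A b {..<m} \<inter> integer_vecs 2) \<and>
      card (rows_polyhedron A b {..<m} \<inter> integer_vecs 2) = k"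
  define S where "S = planar_solutions (\<lambda>i. A $$ (i, 0)) (\<lambda>i. A $$ (i, 1)) (\<lambda>i. b $ i)"
  have poly: "rows_polyhedron A b I \<inter> integer_vecs 2 = point_vec ` S I" if "I \<subseteq> {..<m}" for I
    unfolding S_def by (rule rows_polyhedron_integer[OF A that])
  have fin: "finite (S {..<m})" and card: "card (S {..<m}) = k"
    using fk poly[of "{..<m}"] inj_point_vec
    by (auto simp: finite_image_iff card_image inj_on_subset[OF inj_point_vec])
  obtain I where I: "I \<subseteq> {..<m}" "S I = S {..<m}"
    and least: "\<And>J. J \<subseteq> {..<m} \<and> S J = S {..<m} \<Longrightarrow> card I \<le> card J"
    using ex_has_least_nat[of "\<lambda>J. J \<subseteq> {..<m} \<and> S J = S {..<m}" "{..<m}" card] by auto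
  have finI: "finite I" using I(1) finite_subset by blast
  have irred: "S (I - {i}) \<noteq> S I" if "i \<in> I" for i
  proof
    assume "S (I - {i}) = S I"
    then have "card I \<le> card (I - {i})" using I by (intro least) auto
    then show False using card_Diff1_less[OF finI that] by simp
  qed
  obtain V where V: "helly_config V (S I)" "card V = card I"
    using irredundant_config[OF finI, of "\<lambda>i. A $$ (i, 0)" "\<lambda>i. A $$ (i, 1)" "\<lambda>i. b $ i"]
      fin I(2) irred unfolding S_def by metis
  have "card I + k \<le> 12"
    using helly_config.card_sum_le_12[OF V(1)] V(2) card I(2) assms by simp
  then show "\<exists>I\<subseteq>{..<m}. int (card I) \<le> 12 - int k \<and>
      rows_polyhedron A b I \<inter> integer_vecs 2 = rows_polyhedron A b {..<m} \<inter> integer_vecs 2"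
    using I poly by (intro exI[of _ I]) auto
qed

definition satisfies :: "int \<times> int \<times> int \<Rightarrow> int \<times> int \<Rightarrow> bool" where
  "satisfies r p \<longleftrightarrow> fst r * fst p + fst (snd r) * snd p \<le> snd (snd r)"

text \<open>
If each row excludes a point that all the others admit, then no row can be left out.
\<close>
lemma helly_bound_lower:
  assumes sol: "finite {p. \<forall>r \<in> set rs. satisfies r p}" "card {p. \<forall>r \<in> set rs. satisfies r p} = k"
    and wit: "\<And>i. i < length rs \<Longrightarrow> \<exists>p. \<forall>j < length rs. satisfies (rs ! j) p \<longleftrightarrow> j \<noteq> i"
    and bound: "helly_bound 2 k h"
  shows "int (length rs) \<le> h"
proof -
  define n where "n = length rs"
  define A where "A = mat n 2 (\<lambda>(i, j). real_of_int (if j = 0 then fst (rs ! i) else fst (snd (rs ! i))))"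
  define b where "b = vec n (\<lambda>i. real_of_int (snd (snd (rs ! i))))"
  define S where "S I = {p. \<forall>i \<in> I. satisfies (rs ! i) p}" for I
  have A: "A \<in> carrier_mat n 2" and b: "b \<in> carrier_vec n" unfolding A_def b_def by auto
  have poly: "rows_polyhedron A b I \<inter> integer_vecs 2 = point_vec ` S I" if I: "I \<subseteq> {..<n}" for I
  proof -
    have "A $$ (i, 0) * real_of_int (fst p) + A $$ (i, 1) * real_of_int (snd p) \<le> b $ i
        \<longleftrightarrow> satisfies (rs ! i) p"
      if "i \<in> I" for i p
    proof -
      have "i < n" using that I by auto
      then show ?thesis unfolding A_def b_def satisfies_def
        by (simp flip: of_int_mult of_int_add)
    qed
    then show ?thesis
      unfolding rows_polyhedron_integer[OF A I] planar_solutions_def S_def by simp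
  qed
  have S: "S {..<n} = {p. \<forall>r \<in> set rs. satisfies r p}"
    unfolding S_def n_def by (auto simp: all_set_conv_all_nth)
  have "finite (rows_polyhedron A b {..<n} \<inter> integer_vecs 2)"
    "card (rows_polyhedron A b {..<n} \<inter> integer_vecs 2) = k"
    using sol by (simp_all add: poly S card_image inj_on_subset[OF inj_point_vec])
  then obtain I where I: "I \<subseteq> {..<n}" "int (card I) \<le> h" "point_vec ` S I = point_vec ` S {..<n}"
    using bound A b poly unfolding helly_bound_def by (metis order_refl)
  have "S I = S {..<n}" using I(3) inj_point_vec by (simp add: inj_image_eq_iff)
  have "I = {..<n}"
  proof (rule ccontr)
    assume "I \<noteq> {..<n}"
    then obtain i where i: "i < n" "i \<notin> I" using I(1) by auto
    then obtain p where p: "\<forall>j < n. satisfies (rs ! j) p \<longleftrightarrow> j \<noteq> i" using wit[of i] unfolding n_def by auto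
    then have "p \<in> S I" using i I(1) unfolding S_def by auto
    moreover have "p \<notin> S {..<n}" using p i unfolding S_def by auto
    ultimately show False using \<open>S I = S {..<n}\<close> by simp
  qed
  then show ?thesis using I(2) unfolding n_def by simp
qed

text \<open>
Each row \<open>(a, a', c)\<close> stands for \<open>a * x + a' * y \<le> c\<close> and has slope \<open>\<plusminus>2\<close> or \<open>\<plusminus>1 / 2\<close>. It is the
supporting line at one vertex, moved inwards by one lattice step so as to exclude just that vertex.
\<close>
definition octagon :: "(int \<times> int \<times> int) list" where
  "octagon = [(-1, -2, 1), (1, -2, 2), (2, -1, 3), (2, 1, 4), (1, 2, 4), (-1, 2, 3), (-2, 1, 2), (-2, -1, 1)]"

definition octagon_vertices :: "(int \<times> int) list" where
  "octagon_vertices = [(0, -1), (1, -1), (2, 0), (2, 1), (1, 2), (0, 2), (-1, 1), (-1, 0)]"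

lemma octagon_cut:
  assumes "i < 8" "j < 8"
  shows "satisfies (octagon ! j) (octagon_vertices ! i) \<longleftrightarrow> j \<noteq> i"
proof -
  have "\<forall>i\<in>set [0..<8]. \<forall>j\<in>set [0..<8]. satisfies (octagon ! j) (octagon_vertices ! i) \<longleftrightarrow> j \<noteq> i"
    by code_simp
  then show ?thesis using assms by simp
qed

lemma helly_bound_4_lower:
  assumes "helly_bound 2 4 h"
  shows "8 \<le> h"
proof -
  have sol: "{p. \<forall>r \<in> set octagon. satisfies r p} = {(0, 0), (1, 0), (0, 1), (1, 1)}"
  proof (intro equalityI subsetI)
    fix p assume "p \<in> {p. \<forall>r \<in> set octagon. satisfies r p}"
    then obtain x y where p: "p = (x, y)" and r: "- x - 2 * y \<le> 1" "x - 2 * y \<le> 2" "2 * x - y \<le> 3"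
      "2 * x + y \<le> 4" "x + 2 * y \<le> 4" "- x + 2 * y \<le> 3" "- 2 * x + y \<le> 2" "- 2 * x - y \<le> 1"
      by (cases p) (auto simp: octagon_def satisfies_def)
    have "0 \<le> x" "x \<le> 1" "0 \<le> y" "y \<le> 1"
      using r(7,8) r(3,4) r(1,2) r(5,6) by linarith+
    then have "x = 0 \<or> x = 1" "y = 0 \<or> y = 1" by linarith+
    then show "p \<in> {(0, 0), (1, 0), (0, 1), (1, 1)}" using p by auto
  qed (auto simp: octagon_def satisfies_def)
  have len: "length octagon = 8" by (simp add: octagon_def)
  have "int (length octagon) \<le> h"
  proof (rule helly_bound_lower[OF _ _ _ assms])
    show "\<exists>p. \<forall>j < length octagon. satisfies (octagon ! j) p \<longleftrightarrow> j \<noteq> i" if "i < length octagon" for i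
      using octagon_cut[of i] that unfolding len by blast
  qed (simp_all add: sol)
  then show ?thesis by (simp add: len)
qed

text \<open>
Dropping the row that cuts off \<open>(0, -1)\<close> admits this vertex as fifth solution and nothing else.
\<close>
lemma helly_bound_5_lower:
  assumes "helly_bound 2 5 h"
  shows "7 \<le> h"
proof -
  have sol: "{p. \<forall>r \<in> set (tl octagon). satisfies r p} = {(0, -1), (0, 0), (1, 0), (0, 1), (1, 1)}"
  proof (intro equalityI subsetI)
    fix p assume "p \<in> {p. \<forall>r \<in> set (tl octagon). satisfies r p}"
    then obtain x y where p: "p = (x, y)" and r: "x - 2 * y \<le> 2" "2 * x - y \<le> 3"
      "2 * x + y \<le> 4" "x + 2 * y \<le> 4" "- x + 2 * y \<le> 3" "- 2 * x + y \<le> 2" "- 2 * x - y \<le> 1"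
      by (cases p) (auto simp: octagon_def satisfies_def)
    have x: "0 \<le> x" "x \<le> 1" and "y \<le> 1" using r(6,7) r(2,3) r(4,5) by linarith+
    moreover have "-1 \<le> y" using r(1) x by linarith
    moreover have "y = -1 \<Longrightarrow> x = 0" using r(1) x by linarith
    ultimately have "x = 0 \<or> x = 1" "y = 0 \<or> y = 1 \<or> y = -1 \<and> x = 0" by linarith+
    then show "p \<in> {(0, -1), (0, 0), (1, 0), (0, 1), (1, 1)}" using p by auto
  qed (auto simp: octagon_def satisfies_def)
  have len: "length octagon = 8" by (simp add: octagon_def)
  have "int (length (tl octagon)) \<le> h"
  proof (rule helly_bound_lower[OF _ _ _ assms])
    fix i assume "i < length (tl octagon)"
    then have i: "Suc i < 8" using len by simp
    have "satisfies (tl octagon ! j) (octagon_vertices ! Suc i) \<longleftrightarrow> j \<noteq> i" if "j < length (tl octagon)" for j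
      using octagon_cut[OF i, of "Suc j"] that len by (simp add: nth_tl)
    then show "\<exists>p. \<forall>j < length (tl octagon). satisfies (tl octagon ! j) p \<longleftrightarrow> j \<noteq> i" by blast
  qed (simp_all add: sol)
  then show ?thesis by (simp add: len)
qed

theorem mainTheorem5:
  shows "helly_c 2 5 = 7 \<and> helly_c 2 4 = 8 \<and> helly_c 2 5 < helly_c 2 4 \<and> \<not> mono (helly_c 2)"
proof -
  have 5: "helly_c 2 5 = 7"
    unfolding helly_c_def using helly_bound_upper[of 5] helly_bound_5_lower
    by (intro Least_equality) auto
  have 4: "helly_c 2 4 = 8"
    unfolding helly_c_def using helly_bound_upper[of 4] helly_bound_4_lower
    by (intro Least_equality) auto
  have "\<not> mono (helly_c 2)"
    using monoD[of "helly_c 2" 4 5] 4 5 by auto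
  then show ?thesis using 4 5 by simp
qed

end
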